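(* Let $H$ be a $3$-uniform hypergraph with $m$ edges. Then $H$ has a $2$-cut with excess at least $\left(\sqrt{24m+1}-1\right)/16$. If $H$ is connected and has $n$ vertices, then $H$ has a $2$-cut with excess at least $(n-1)/8$. Both bounds are best possible: if $H$ is any Steiner triple system, then the maximum excess of a $2$-cut of $H$ equals $\left(\sqrt{24m+1}-1\right)/16=(n-1)/8$. Moreover, if $H$ is a $3$-uniform hypergraph with $n$ vertices, none of which is isolated, then $H$ has a $2$-cut with excess at least $n/12$. This bound is also best possible: if $H$ is a perfect matching, the maximum excess of a $2$-cut of $H$ equals $n/12$.
   Context: A $k$-uniform hypergraph ($k$-graph) has a vertex set and a set of $k$-element subsets (edges). For $2\le r\le k$, an $r$-cut of a $k$-graph $H$ is a partition of $V(H)$ into $r$ (possibly empty) labelled parts; its size is the number of edges having a vertex in every part (such edges are called multicoloured). The excess of an $r$-cut of an $m$-edge $k$-graph is its size minus $\frac{S(k,r)r!}{r^k}m$, where $S(k,r)$ is the Stirling number of the second kind; this subtracted quantity is the expected size of a uniformly random $r$-cut. For $k=3,r=2$ it equals $\frac34 m$. A Steiner triple system is a $3$-graph in which every pair of vertices lies in exactly one edge. A perfect matching is a $k$-graph in which every vertex lies in exactly one edge. A vertex is isolated if it lies in no edge. *)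

theory Defs
  imports Complex_Main "HOL-Library.Disjoint_Sets" "HOL-Combinatorics.Stirling"
begin

text \<open>A hypergraph is given by its vertex set \<open>V\<close> and edge set \<open>E\<close>; hypergraphs are finite and
  have no repeated edges.\<close>

definition uniform_hypergraph :: "nat \<Rightarrow> 'a set \<Rightarrow> 'a set set \<Rightarrow> bool" where
  "uniform_hypergraph k V E \<longleftrightarrow> finite V \<and> (\<forall>e\<in>E. e \<subseteq> V \<and> card e = k)"

text \<open>The labelled parts are \<open>P 0, \<dots>, P (r - 1)\<close>, some of which may be empty. The values \<open>P i\<close>
  with \<open>i \<ge> r\<close> are irrelevant.\<close>

definition is_cut :: "nat \<Rightarrow> 'a set \<Rightarrow> (nat \<Rightarrow> 'a set) \<Rightarrow> bool" where
  "is_cut r V P \<longleftrightarrow> disjoint_family_on P {..<r} \<and> (\<Union>i<r. P i) = V"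

definition multicoloured :: "nat \<Rightarrow> (nat \<Rightarrow> 'a set) \<Rightarrow> 'a set \<Rightarrow> bool" where
  "multicoloured r P e \<longleftrightarrow> (\<forall>i<r. e \<inter> P i \<noteq> {})"

definition cut_size :: "nat \<Rightarrow> 'a set set \<Rightarrow> (nat \<Rightarrow> 'a set) \<Rightarrow> nat" where
  "cut_size r E P = card {e \<in> E. multicoloured r P e}"

definition excess :: "nat \<Rightarrow> nat \<Rightarrow> 'a set set \<Rightarrow> (nat \<Rightarrow> 'a set) \<Rightarrow> real" where
  "excess k r E P =
     real (cut_size r E P) - real (Stirling k r) * fact r / real r ^ k * real (card E)"

definition max_excess :: "nat \<Rightarrow> nat \<Rightarrow> 'a set \<Rightarrow> 'a set set \<Rightarrow> real" where
  "max_excess k r V E = Max {excess k r E P | P. is_cut r V P}"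

definition connected_hypergraph :: "'a set \<Rightarrow> 'a set set \<Rightarrow> bool" where
  "connected_hypergraph V E \<longleftrightarrow>
     (\<forall>u\<in>V. \<forall>v\<in>V. (u, v) \<in> {(x, y). \<exists>e\<in>E. x \<in> e \<and> y \<in> e}\<^sup>*)"

definition isolated :: "'a set set \<Rightarrow> 'a \<Rightarrow> bool" where
  "isolated E v \<longleftrightarrow> (\<forall>e\<in>E. v \<notin> e)"

text \<open>The vertex set of a Steiner triple system is required to be nonempty: the empty hypergraph
  has maximum excess \<open>0\<close>, not \<open>(0 - 1) / 8\<close>. The one-vertex system is allowed.\<close>

definition steiner_triple_system :: "'a set \<Rightarrow> 'a set set \<Rightarrow> bool" where
  "steiner_triple_system V E \<longleftrightarrow> uniform_hypergraph 3 V E \<and> V \<noteq> {} \<and>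
     (\<forall>u\<in>V. \<forall>v\<in>V. u \<noteq> v \<longrightarrow> (\<exists>!e. e \<in> E \<and> u \<in> e \<and> v \<in> e))"

definition perfect_matching :: "nat \<Rightarrow> 'a set \<Rightarrow> 'a set set \<Rightarrow> bool" where
  "perfect_matching k V E \<longleftrightarrow> uniform_hypergraph k V E \<and> (\<forall>v\<in>V. \<exists>!e. e \<in> E \<and> v \<in> e)"

lemma excess_3_2: "excess 3 2 E P = real (cut_size 2 E P) - 3 / 4 * real (card E)"
  by (simp add: excess_def numeral_eq_Suc)

text \<open>The maximum defining \<^const>\<open>max_excess\<close> is over a finite nonempty set.\<close>

lemma finite_excess_values:
  assumes "uniform_hypergraph k V E"
  shows "finite {excess k r E P | P. is_cut r V P}"
proof -
  have "E \<subseteq> Pow V" "finite V"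
    using assms by (auto simp: uniform_hypergraph_def)
  then have "finite E"
    by (meson finite_Pow_iff finite_subset)
  then have "cut_size r E P \<in> {..card E}" for P
    by (auto simp: cut_size_def intro: card_mono)
  then have "{excess k r E P | P. is_cut r V P} \<subseteq>
      (\<lambda>s. real s - real (Stirling k r) * fact r / real r ^ k * real (card E)) ` {..card E}"
    by (auto simp: excess_def)
  then show ?thesis
    by (rule finite_subset) simp
qed

lemma excess_values_nonempty:
  assumes "r > 0"
  shows "{excess k r E P | P. is_cut r V P} \<noteq> {}"
proof -
  have "is_cut r V (\<lambda>i. if i = 0 then V else {})"
    using assms by (auto simp: is_cut_def disjoint_family_on_def)
  then show ?thesis by blast
qed

end

theory Submission
  imports Defs
begin

text \<open>
  Encode a 2-cut by signs x. A triple misses being multicoloured exactly when its signs agree, so the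
  excess is -1/8 times the sum of w(u, v) x(u) x(v) over ordered pairs, where w is the codegree: the
  problem becomes the Edwards bound for max-cut in a multigraph. The attainable negated sums (gains)
  are superadditive over disjoint vertex sets, because flipping all signs on one set makes the cross
  term nonpositive. In a connected graph, partition the vertices into the stars formed by the
  vertices at even (or odd) depth of a depth-first search tree and their children; one of the two
  choices uses half of the tree edges. For the bound in m, take a proper colouring with fewest colours,
  so that any two of the k colour classes are joined by an edge, and split the pairs of classes into k
  matchings; the best one has gain at least 1/k of the total weight.\<close>

section \<open>Signed energies and gains in a weighted graph\<close>

locale weighted_graph =
  fixes w :: "'a \<Rightarrow> 'a \<Rightarrow> real"
  assumes sym: "w u v = w v u"
    and irrefl [simp]: "w v v = 0"
    and weight: "w u v = 0 \<or> w u v \<ge> 1"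
begin

definition energy :: "'a set \<Rightarrow> ('a \<Rightarrow> real) \<Rightarrow> real" where
  "energy S x = (\<Sum>u\<in>S. \<Sum>v\<in>S. w u v * x u * x v)"

text \<open>Only a lower bound on the best value of \<open>- energy S x\<close> is recorded, so that
  gains can be weakened and added. Energies run over ordered pairs; for codegree weights a gain g
  yields an excess of g / 8.\<close>

definition gain :: "'a set \<Rightarrow> real \<Rightarrow> bool" where
  "gain S g \<longleftrightarrow> (\<exists>x. (\<forall>v. x v \<in> {-1, 1}) \<and> energy S x \<le> - g)"

lemma nonneg: "w u v \<ge> 0"
  using weight[of u v] by auto

lemma energy_cong: "(\<And>v. v \<in> S \<Longrightarrow> x v = y v) \<Longrightarrow> energy S x = energy S y"
  unfolding energy_def by (intro sum.cong) auto

lemma energy_Un: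
  assumes "finite S" "finite T" "S \<inter> T = {}"
  shows "energy (S \<union> T) x =
    energy S x + energy T x + 2 * (\<Sum>u\<in>S. \<Sum>v\<in>T. w u v * x u * x v)"
proof -
  have "(\<Sum>u\<in>T. \<Sum>v\<in>S. w u v * x u * x v) = (\<Sum>u\<in>S. \<Sum>v\<in>T. w u v * x u * x v)"
    by (subst sum.swap) (intro sum.cong refl, simp add: sym mult_ac)
  then show ?thesis
    using assms by (simp add: energy_def sum.union_disjoint sum.distrib)
qed

lemma gain_Un:
  assumes "finite S" "finite T" "S \<inter> T = {}" "gain S a" "gain T b"
  shows "gain (S \<union> T) (a + b)"
proof -
  obtain x y where x: "\<And>v. x v \<in> {-1, 1}" "energy S x \<le> - a"
    and y: "\<And>v. y v \<in> {-1, 1}" "energy T y \<le> - b"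
    using assms(4,5) unfolding gain_def by blast
  define c where "c = (\<Sum>u\<in>S. \<Sum>v\<in>T. w u v * x u * y v)"
  \<comment> \<open>A global flip on \<open>T\<close> preserves the energy of \<open>T\<close> and
    negates the cross term; this choice turns it into minus the absolute value of
    \<open>c\<close>.\<close>
  define e :: real where "e = (if c \<le> 0 then 1 else -1)"
  define z where "z v = (if v \<in> S then x v else e * y v)" for v
  have zT: "z v = e * y v" if "v \<in> T" for v
    using that assms(3) by (auto simp: z_def)
  have "energy S z = energy S x"
    by (rule energy_cong) (simp add: z_def)
  moreover have "energy T z = energy T y"
    unfolding energy_def by (intro sum.cong refl) (simp add: zT, simp add: e_def)
  moreover have "(\<Sum>u\<in>S. \<Sum>v\<in>T. w u v * z u * z v) = e * c"
    unfolding c_def sum_distrib_left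
    by (intro sum.cong refl) (simp add: zT, simp add: z_def mult_ac)
  moreover have "e * c \<le> 0"
    by (simp add: e_def)
  ultimately have "energy (S \<union> T) z \<le> - (a + b)"
    using energy_Un[OF assms(1-3), of z] x(2) y(2) by linarith
  moreover have "z v \<in> {-1, 1}" for v
    using x(1)[of v] y(1)[of v] by (auto simp: z_def e_def)
  ultimately show ?thesis
    unfolding gain_def by blast
qed

lemma gain_mono: "gain S a \<Longrightarrow> b \<le> a \<Longrightarrow> gain S b"
  unfolding gain_def by (meson neg_le_iff_le order_trans)

lemma gain_empty: "gain {} 0"
  unfolding gain_def energy_def by (auto intro: exI[of _ "\<lambda>_. 1"])

lemma gain_singleton: "gain {v} 0"
  unfolding gain_def energy_def by (auto intro: exI[of _ "\<lambda>_. 1"])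

text \<open>Within \<open>S\<close> only \<open>r\<close> can be a neighbour of \<open>t\<close>, so
  giving \<open>t\<close> the sign opposite to that of \<open>r\<close> gains all of
  \<open>w r t\<close>, once for each order of the pair.\<close>

lemma gain_attach_leaf:
  assumes "finite S" "r \<in> S" "t \<notin> S" "\<And>v. v \<in> S - {r} \<Longrightarrow> w v t = 0" "gain S g"
  shows "gain (insert t S) (g + 2 * w r t)"
proof -
  obtain x where x: "\<And>v. x v \<in> {-1, 1}" "energy S x \<le> - g"
    using assms(5) unfolding gain_def by blast
  define z where "z = x(t := - x r)"
  have "(\<Sum>u\<in>S. \<Sum>v\<in>{t}. w u v * z u * z v) = (\<Sum>u\<in>S. if u = r then - w r t else 0)"
  proof (rule sum.cong)
    fix u assume "u \<in> S"
    then show "(\<Sum>v\<in>{t}. w u v * z u * z v) = (if u = r then - w r t else 0)"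
      using x(1)[of r] assms(3,4) by (auto simp: z_def)
  qed simp
  also have "\<dots> = - w r t"
    using assms by simp
  finally have c: "(\<Sum>u\<in>S. \<Sum>v\<in>{t}. w u v * z u * z v) = - w r t" .
  have "energy S z = energy S x"
    using assms(3) by (intro energy_cong) (auto simp: z_def)
  moreover have "energy {t} z = 0"
    by (simp add: energy_def)
  ultimately have "energy (insert t S) z \<le> - (g + 2 * w r t)"
    using energy_Un[of S "{t}" z] c x(2) assms(1,3) by simp
  moreover have "z v \<in> {-1, 1}" for v
    using x(1)[of v] x(1)[of r] by (auto simp: z_def)
  ultimately show ?thesis
    unfolding gain_def by blast
qed

section \<open>Components and the linear bound for connected graphs\<close>

definition adj :: "'a set \<Rightarrow> ('a \<times> 'a) set" where
  "adj S = {(u, v). u \<in> S \<and> v \<in> S \<and> w u v \<noteq> 0}"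

definition rooted :: "'a set \<Rightarrow> 'a \<Rightarrow> bool" where
  "rooted S r \<longleftrightarrow> r \<in> S \<and> (\<forall>v\<in>S. (v, r) \<in> (adj S)\<^sup>*)"

definition component :: "'a set \<Rightarrow> 'a \<Rightarrow> 'a set" where
  "component S r = {v. (v, r) \<in> (adj S)\<^sup>*}"

lemma component_subset: "r \<in> S \<Longrightarrow> component S r \<subseteq> S"
  unfolding component_def adj_def by (auto elim: converse_rtranclE)

lemma root_in_component [simp]: "r \<in> component S r"
  by (simp add: component_def)

lemma component_closed:
  "u \<in> S \<Longrightarrow> v \<in> S \<Longrightarrow> w u v \<noteq> 0 \<Longrightarrow> v \<in> component S r \<Longrightarrow> u \<in> component S r"
  unfolding component_def adj_def by (auto intro: converse_rtrancl_into_rtrancl)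

lemma rooted_component: "rooted (component S r) r"
proof -
  have "(v, r) \<in> (adj (component S r))\<^sup>*" if "(v, r) \<in> (adj S)\<^sup>*" for v
    using that
  proof (induction rule: converse_rtrancl_induct)
    case (step u v)
    then have "(u, v) \<in> adj (component S r)"
      by (auto simp: adj_def component_def intro: converse_rtrancl_into_rtrancl)
    then show ?case
      using step.IH by (rule converse_rtrancl_into_rtrancl)
  qed simp
  then show ?thesis
    by (auto simp: rooted_def component_def)
qed

text \<open>A component of \<open>S - {r}\<close> is joined to the rest of \<open>S\<close> only
  through \<open>r\<close>, so a path to \<open>r\<close> from outside the component can be stopped
  at its first visit to \<open>r\<close> and never enters it. This splits one branch off the search
  tree.\<close>

lemma rooted_Diff_component:
  assumes "rooted S r" "t \<in> S - {r}"
  shows "rooted (S - component (S - {r}) t) r"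
proof -
  define C where "C = component (S - {r}) t"
  have "C \<subseteq> S - {r}"
    unfolding C_def using assms(2) by (rule component_subset)
  have "v \<in> S - C \<longrightarrow> (v, r) \<in> (adj (S - C))\<^sup>*" if "(v, r) \<in> (adj S)\<^sup>*" for v
    using that
  proof (induction rule: converse_rtrancl_induct)
    case (step u v)
    show ?case
    proof (cases "u = r")
      case False
      have "v \<notin> C" if "u \<in> S - C"
        using component_closed[of u "S - {r}" v t] step.hyps(1) that False \<open>C \<subseteq> S - {r}\<close>
        by (auto simp: C_def adj_def)
      then show ?thesis
        using step by (auto simp: adj_def intro: converse_rtrancl_into_rtrancl)
    qed simp
  qed simp
  then show ?thesis
    using assms(1) \<open>C \<subseteq> S - {r}\<close> unfolding rooted_def C_def by blast
qed

text \<open>This telescopes over a depth-first search tree: the even levels of the tree and the odd levels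
  are the centres of two star partitions, which together use every tree edge once.\<close>

lemma rooted_gain_sum:
  assumes "finite S" "rooted S r"
  shows "\<exists>a b. gain S a \<and> gain (S - {r}) b \<and> a + b \<ge> 2 * (real (card S) - 1)"
  using assms
proof (induction "card S" arbitrary: S r rule: less_induct)
  case less
  show ?case
  proof (cases "S = {r}")
    case True
    then show ?thesis
      using gain_empty gain_singleton[of r] by (intro exI[of _ 0]) auto
  next
    case False
    have "r \<in> S"
      using less.prems by (simp add: rooted_def)
    then obtain v where "v \<in> S" "v \<noteq> r"
      using False by blast
    then have "(v, r) \<in> (adj S)\<^sup>*"
      using less.prems by (simp add: rooted_def)
    then obtain t where "(t, r) \<in> adj S"
      using \<open>v \<noteq> r\<close> by (cases rule: rtranclE) auto
    then have t: "t \<in> S - {r}" "w r t \<noteq> 0"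
      using sym[of r t] by (auto simp: adj_def)
    \<comment> \<open>The branch below the child \<open>t\<close> of \<open>r\<close>. The induction
      applies to \<open>C\<close> with root \<open>t\<close> and to \<open>S - C\<close> with root
      \<open>r\<close>.\<close>
    define C where "C = component (S - {r}) t"
    have C: "C \<subseteq> S - {r}" "t \<in> C"
      using component_subset[OF t(1)] by (auto simp: C_def)
    then have "finite C"
      using less.prems(1) finite_subset by blast
    have card: "card S = card C + card (S - C)"
      using C less.prems(1) \<open>finite C\<close> by (metis Diff_subset card_Diff_subset card_mono
        le_add_diff_inverse order_trans)
    moreover have "card C > 0" "card (S - C) > 0"
      using C \<open>r \<in> S\<close> less.prems(1) \<open>finite C\<close> by (auto simp: card_gt_0_iff)
    ultimately have lt: "card C < card S" "card (S - C) < card S"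
      by auto
    \<comment> \<open>In \<open>a\<close> the root \<open>t\<close> is the centre of a star; in
      \<open>b\<close> it is left out, free to join the star at \<open>r\<close>.\<close>
    obtain a b where ab: "gain C a" "gain (C - {t}) b" "a + b \<ge> 2 * (real (card C) - 1)"
      using less.hyps[OF lt(1) \<open>finite C\<close>] rooted_component unfolding C_def by blast
    obtain a' b' where ab': "gain (S - C) a'" "gain (S - C - {r}) b'"
      "a' + b' \<ge> 2 * (real (card (S - C)) - 1)"
      using less.hyps[OF lt(2)] rooted_Diff_component[OF less.prems(2) t(1)] less.prems(1)
      unfolding C_def by blast
    \<comment> \<open>First choice: \<open>t\<close> is a leaf of the star at \<open>r\<close>. Any
      neighbour of \<open>t\<close> in \<open>S - {r}\<close> lies in \<open>C\<close>, so
      \<open>t\<close> has no other neighbour in \<open>S - C\<close>.\<close>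
    have "gain (insert t (S - C)) (a' + 2 * w r t)"
    proof (rule gain_attach_leaf)
      show "w v t = 0" if "v \<in> S - C - {r}" for v
        using component_closed[of v "S - {r}" t t] that t(1) C(2) by (auto simp: C_def)
    qed (use C \<open>r \<in> S\<close> less.prems(1) ab' in auto)
    then have "gain (insert t (S - C) \<union> (C - {t})) (a' + 2 * w r t + b)"
      using ab(2) less.prems(1) \<open>finite C\<close> by (intro gain_Un) auto
    moreover have "insert t (S - C) \<union> (C - {t}) = S"
      using C by auto
    \<comment> \<open>Second choice: \<open>r\<close> is left out, and \<open>t\<close> is a
      centre.\<close>
    moreover have "gain ((S - C - {r}) \<union> C) (b' + a)"
      using ab(1) ab'(2) less.prems(1) \<open>finite C\<close> by (intro gain_Un) auto
    moreover have "(S - C - {r}) \<union> C = S - {r}"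
      using C by auto
    moreover have "w r t \<ge> 1"
      using weight[of r t] t(2) by auto
    \<comment> \<open>The induction hypotheses subtract 1 from two cardinalities where the goal
      subtracts it once; the term \<open>2 * w r t\<close> makes up the difference of 2.\<close>
    then have "(a' + 2 * w r t + b) + (b' + a) \<ge> 2 * (real (card S) - 1)"
      using ab(3) ab'(3) card by simp
    ultimately show ?thesis
      by metis
  qed
qed

text \<open>The larger of the two gains is at least half their sum, and a missing root returns as a
  singleton of gain 0.\<close>

lemma rooted_gain:
  assumes "finite S" "rooted S r"
  shows "gain S (real (card S) - 1)"
proof -
  obtain a b where ab: "gain S a" "gain (S - {r}) b" "a + b \<ge> 2 * (real (card S) - 1)"
    using rooted_gain_sum[OF assms] by blast
  have "gain ((S - {r}) \<union> {r}) (b + 0)"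
    using assms(1) ab(2) gain_singleton by (intro gain_Un) auto
  moreover have "(S - {r}) \<union> {r} = S"
    using assms(2) by (auto simp: rooted_def)
  ultimately have "gain S b"
    by simp
  then show ?thesis
    using gain_mono[OF ab(1)] gain_mono[of S b] ab(3) by (cases "a \<le> b") auto
qed

section \<open>The bound for minimum degree two\<close>

text \<open>Without loops, two distinct neighbours force each component to have s \<ge> 3 vertices,
  and then its gain s - 1 is at least 2 s / 3, with equality at s = 3. Components are removed one at
  a time.\<close>

lemma gain_min_degree_two:
  assumes "finite S"
    and "\<And>v. v \<in> S \<Longrightarrow> \<exists>a\<in>S. \<exists>b\<in>S. a \<noteq> b \<and> w v a \<noteq> 0 \<and> w v b \<noteq> 0"
  shows "gain S (2 / 3 * real (card S))"
  using assms
proof (induction "card S" arbitrary: S rule: less_induct)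
  case less
  show ?case
  proof (cases "S = {}")
    case True
    then show ?thesis
      using gain_empty by simp
  next
    case False
    then obtain r where r: "r \<in> S"
      by blast
    define C where "C = component S r"
    have C: "C \<subseteq> S" "r \<in> C"
      using component_subset[OF r] by (auto simp: C_def)
    then have "finite C"
      using less.prems(1) finite_subset by blast
    obtain a b where ab: "a \<in> S" "b \<in> S" "a \<noteq> b" "w r a \<noteq> 0" "w r b \<noteq> 0"
      using less.prems(2)[OF r] by blast
    have "a \<in> C" "b \<in> C"
      using component_closed[of _ S r r] ab r by (auto simp: C_def sym)
    then have "{a, b, r} \<subseteq> C"
      using C by auto
    then have "card {a, b, r} \<le> card C"
      using \<open>finite C\<close> card_mono by blast
    moreover have "a \<noteq> r" "b \<noteq> r"
      using ab by auto
    ultimately have C3: "card C \<ge> 3"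
      using ab(3) by simp
    have card: "card S = card C + card (S - C)"
      using C less.prems(1) \<open>finite C\<close> by (metis card_Diff_subset card_mono le_add_diff_inverse)
    have gC: "gain C (real (card C) - 1)"
      using rooted_gain[OF \<open>finite C\<close>] rooted_component unfolding C_def by blast
    have gD: "gain (S - C) (2 / 3 * real (card (S - C)))"
    proof (rule less.hyps)
      show "card (S - C) < card S" "finite (S - C)"
        using card C3 less.prems(1) by auto
      fix v assume v: "v \<in> S - C"
      then obtain a b where "a \<in> S" "b \<in> S" "a \<noteq> b" "w v a \<noteq> 0" "w v b \<noteq> 0"
        using less.prems(2)[of v] by blast
      moreover from this have "a \<notin> C" "b \<notin> C"
        using component_closed[of v S _ r] v by (auto simp: C_def)
      ultimately show "\<exists>a\<in>S - C. \<exists>b\<in>S - C. a \<noteq> b \<and> w v a \<noteq> 0 \<and> w v b \<noteq> 0"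
        by blast
    qed
    have "gain (C \<union> (S - C)) (real (card C) - 1 + 2 / 3 * real (card (S - C)))"
      using gC gD less.prems(1) \<open>finite C\<close> by (intro gain_Un) auto
    moreover have "C \<union> (S - C) = S"
      using C by auto
    ultimately show ?thesis
      using C3 card by (auto elim!: gain_mono)
  qed
qed

section \<open>Colourings and the bound in terms of the total weight\<close>

definition proper :: "'a set \<Rightarrow> nat \<Rightarrow> ('a \<Rightarrow> nat) \<Rightarrow> bool" where
  "proper S k c \<longleftrightarrow> (\<forall>v\<in>S. c v < k) \<and> (\<forall>u\<in>S. \<forall>v\<in>S. c u = c v \<longrightarrow> w u v = 0)"

text \<open>Ordered pairs again: this is twice the sum of the edge weights.\<close>

definition total :: "'a set \<Rightarrow> real" where
  "total S = (\<Sum>u\<in>S. \<Sum>v\<in>S. w u v)"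

text \<open>In a proper colouring with the fewest colours, two classes without an edge between them
  could be merged.\<close>

lemma ex_complete_colouring:
  assumes "finite S"
  shows "\<exists>k c. proper S k c \<and>
    (\<forall>i<k. \<forall>j<k. i \<noteq> j \<longrightarrow> (\<exists>u\<in>S. \<exists>v\<in>S. c u = i \<and> c v = j \<and> w u v \<noteq> 0))"
proof -
  obtain f :: "'a \<Rightarrow> nat" where "inj_on f S" "f ` S = {..<card S}"
    using ex_bij_betw_finite_nat[OF assms] by (auto simp: bij_betw_def atLeast0LessThan)
  then have "proper S (card S) f"
    unfolding proper_def using irrefl by (auto simp: inj_on_def)
  then have ex: "\<exists>k c. proper S k c"
    by blast
  define k where "k = (LEAST k. \<exists>c. proper S k c)"
  obtain c where c: "proper S k c"
    using LeastI_ex[OF ex] unfolding k_def by blast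
  have joined: "\<exists>u\<in>S. \<exists>v\<in>S. c u = i \<and> c v = j \<and> w u v \<noteq> 0" if ij: "i < j" "j < k" for i j
  proof (rule ccontr)
    assume neg: "\<not> ?thesis"
    \<comment> \<open>Class \<open>j\<close> is merged into class \<open>i\<close>, and the last
      colour \<open>k - 1\<close> takes over the freed name \<open>j\<close>. If \<open>j\<close> is
      itself the last colour, the first case prevails.\<close>
    define d where "d v = (if c v = j then i else if c v = k - 1 then j else c v)" for v
    have "d v < k - 1" if "v \<in> S" for v
    proof -
      have "c v < k"
        using c that by (simp add: proper_def)
      then show ?thesis
        using ij by (auto simp: d_def)
    qed
    moreover have "w u v = 0" if uv: "u \<in> S" "v \<in> S" "d u = d v" for u v
    proof -
      have "c u < k" "c v < k"
        using c uv by (auto simp: proper_def)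
      then have "c u = c v \<or> c u = i \<and> c v = j \<or> c u = j \<and> c v = i"
        using uv(3) ij by (auto simp: d_def split: if_splits)
      then show ?thesis
        using neg c uv(1,2) sym[of u v] unfolding proper_def by metis
    qed
    ultimately have "\<exists>c. proper S (k - 1) c"
      unfolding proper_def by blast
    then have "k \<le> k - 1"
      unfolding k_def by (rule Least_le)
    then show False
      using ij by simp
  qed
  have "\<exists>u\<in>S. \<exists>v\<in>S. c u = i \<and> c v = j \<and> w u v \<noteq> 0" if "i < k" "j < k" "i \<noteq> j" for i j
    using joined[of i j] joined[of j i] that sym by (metis nat_neq_iff)
  with c show ?thesis
    by blast
qed

text \<open>Matched classes get opposite signs and, being independent, gain all the weight between
  them; \<open>gain_Un\<close> assembles the pairs without loss. Fixed points of
  \<open>\<sigma>\<close> are allowed and contribute 0.\<close>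

lemma gain_matching:
  assumes "finite I" "finite S" "\<And>v. v \<in> S \<Longrightarrow> c v \<in> I"
    and inv: "\<And>i. i \<in> I \<Longrightarrow> \<sigma> i \<in> I \<and> \<sigma> (\<sigma> i) = i"
    and indep: "\<And>u v. u \<in> S \<Longrightarrow> v \<in> S \<Longrightarrow> c u = c v \<Longrightarrow> w u v = 0"
  shows "gain S (\<Sum>u\<in>S. \<Sum>v\<in>S. if c v = \<sigma> (c u) then w u v else 0)"
  using assms
proof (induction "card I" arbitrary: I S rule: less_induct)
  case less
  let ?m = "\<lambda>u v. if c v = \<sigma> (c u) then w u v else 0"
  show ?case
  proof (cases "I = {}")
    case True
    then have "S = {}"
      using less.prems(3) by auto
    then show ?thesis
      using gain_empty by simp
  next
    case False
    then obtain i where i: "i \<in> I"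
      by blast
    define J where "J = I - {i, \<sigma> i}"
    define A where "A = {v \<in> S. c v \<in> {i, \<sigma> i}}"
    define B where "B = {v \<in> S. c v \<in> J}"
    have fin: "finite A" "finite B"
      using less.prems(2) by (auto simp: A_def B_def)
    have S: "S = A \<union> B" "A \<inter> B = {}"
      using less.prems(3) by (auto simp: A_def B_def J_def)
    have m: "\<sigma> (\<sigma> i) = i"
      using less.prems(4)[OF i] by simp
    \<comment> \<open>No matched pair runs between \<open>A\<close> and \<open>B\<close>, so the
      double sum splits with no mixed terms.\<close>
    have cross: "?m u v = 0" "?m v u = 0" if "u \<in> A" "v \<in> B" for u v
    proof -
      have "c u \<in> {i, \<sigma> i}" "c v \<in> I" "c v \<noteq> i" "c v \<noteq> \<sigma> i"
        using that by (auto simp: A_def B_def J_def)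
      then have "c v \<noteq> \<sigma> (c u)" "c u \<noteq> \<sigma> (c v)"
        using m less.prems(4)[of "c v"] by auto
      then show "?m u v = 0" "?m v u = 0"
        by auto
    qed
    have "gain B (\<Sum>u\<in>B. \<Sum>v\<in>B. ?m u v)"
    proof (rule less.hyps)
      show "card J < card I"
        using i less.prems(1) by (auto simp: J_def intro!: psubset_card_mono)
      show "\<sigma> j \<in> J \<and> \<sigma> (\<sigma> j) = j" if "j \<in> J" for j
        using less.prems(4)[of j] that m by (auto simp: J_def)
    qed (use less.prems in \<open>auto simp: J_def B_def\<close>)
    moreover have "gain A (\<Sum>u\<in>A. \<Sum>v\<in>A. ?m u v)"
    proof -
      define x :: "'a \<Rightarrow> real" where "x v = (if c v = i then 1 else -1)" for v
      have "w u v * x u * x v = - ?m u v" if "u \<in> A" "v \<in> A" for u v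
        using that less.prems(5)[of u v] m by (cases "c u = c v") (auto simp: A_def x_def)
      then have "energy A x = - (\<Sum>u\<in>A. \<Sum>v\<in>A. ?m u v)"
        unfolding energy_def sum_negf[symmetric] by (intro sum.cong) auto
      then show ?thesis
        unfolding gain_def by (intro exI[of _ x]) (auto simp: x_def)
    qed
    ultimately have "gain (A \<union> B) ((\<Sum>u\<in>A. \<Sum>v\<in>A. ?m u v) + (\<Sum>u\<in>B. \<Sum>v\<in>B. ?m u v))"
      using fin S by (intro gain_Un) auto
    moreover have "(\<Sum>u\<in>S. \<Sum>v\<in>S. ?m u v) = (\<Sum>u\<in>A. \<Sum>v\<in>A. ?m u v) + (\<Sum>u\<in>B. \<Sum>v\<in>B. ?m u v)"
    proof -
      have "(\<Sum>v\<in>B. ?m u v) = 0" if "u \<in> A" for u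
        using cross(1) that by (intro sum.neutral) blast
      moreover have "(\<Sum>v\<in>A. ?m u v) = 0" if "u \<in> B" for u
        using cross(2) that by (intro sum.neutral) blast
      ultimately show ?thesis
        unfolding S(1) sum.union_disjoint[OF fin S(2)] sum.distrib by (simp cong: sum.cong)
    qed
    ultimately show ?thesis
      using S(1) by simp
  qed
qed

text \<open>A round-robin schedule: every ordered pair of colours, equal ones included, is matched
  in exactly one of \<open>k\<close> rounds. The gains of the rounds therefore sum to
  \<open>total S\<close>, and some round reaches the average.\<close>

lemma gain_total_div:
  assumes "finite S" "proper S k c" "S \<noteq> {}"
  shows "gain S (total S / k)"
proof -
  have "k > 0"
    using assms by (auto simp: proper_def)
  \<comment> \<open>The classes i and j are matched in round s iff i + j is s modulo k.\<close>
  define \<sigma> where "\<sigma> s i = (s + (k - i)) mod k" for s i :: nat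
  have \<sigma>_iff: "j = \<sigma> s i \<longleftrightarrow> s = (i + j) mod k" if "i < k" "j < k" "s < k" for s i j
  proof (cases "i \<le> s")
    \<comment> \<open>Here \<open>s + (k - i)\<close> is at least \<open>k\<close> and reduces to
      \<open>s - i\<close>; in the other case it is already below \<open>k\<close>.\<close>
    case True
    then have "\<sigma> s i = (s - i + k) mod k"
      using that by (simp add: \<sigma>_def)
    then have "\<sigma> s i = s - i"
      using that by simp
    then show ?thesis
      using True that by (auto simp: mod_if)
  next
    case False
    then have "\<sigma> s i = s + (k - i)"
      using that by (simp add: \<sigma>_def)
    then show ?thesis
      using False that by (auto simp: mod_if)
  qed
  let ?m = "\<lambda>s u v. if c v = \<sigma> s (c u) then w u v else 0"
  define M where "M s = (\<Sum>u\<in>S. \<Sum>v\<in>S. ?m s u v)" for s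
  have "(\<Sum>s<k. M s) = (\<Sum>u\<in>S. \<Sum>v\<in>S. \<Sum>s<k. ?m s u v)"
    unfolding M_def by (subst sum.swap) (intro sum.cong refl, rule sum.swap)
  also have "\<dots> = total S"
    unfolding total_def
  proof (intro sum.cong refl)
    fix u v assume "u \<in> S" "v \<in> S"
    then have "c u < k" "c v < k"
      using assms(2) by (auto simp: proper_def)
    then have "(\<Sum>s<k. ?m s u v) = (\<Sum>s<k. if s = (c u + c v) mod k then w u v else 0)"
      using \<sigma>_iff by (intro sum.cong) auto
    also have "\<dots> = w u v"
      using \<open>k > 0\<close> by simp
    finally show "(\<Sum>s<k. ?m s u v) = w u v" .
  qed
  finally have tot: "(\<Sum>s<k. M s) = total S" .
  have "\<exists>s<k. total S / k \<le> M s"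
  proof (rule ccontr)
    assume "\<not> ?thesis"
    then have "M s < total S / k" if "s < k" for s
      using that by auto
    then have "(\<Sum>s<k. M s) < (\<Sum>s<k. total S / k)"
      using \<open>k > 0\<close> by (intro sum_strict_mono) auto
    then show False
      using tot \<open>k > 0\<close> by simp
  qed
  then obtain s where s: "s < k" "total S / k \<le> M s"
    by blast
  have "gain S (M s)"
    unfolding M_def
  proof (rule gain_matching[where I = "{..<k}"])
    fix i assume i: "i \<in> {..<k}"
    then have "\<sigma> s i < k"
      using \<open>k > 0\<close> by (simp add: \<sigma>_def)
    then show "\<sigma> s i \<in> {..<k} \<and> \<sigma> s (\<sigma> s i) = i"
      using \<sigma>_iff[of i "\<sigma> s i" s] \<sigma>_iff[of "\<sigma> s i" i s] i s(1) by (simp add: add.commute)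
  qed (use assms in \<open>auto simp: proper_def\<close>)
  then show ?thesis
    using s(2) by (rule gain_mono)
qed

text \<open>The right-hand side counts ordered pairs of distinct colours. Each is the colour pair of
  some adjacent ordered pair of vertices, which has weight at least 1.\<close>

lemma total_ge:
  assumes "finite S"
    and "\<forall>i<k. \<forall>j<k. i \<noteq> j \<longrightarrow> (\<exists>u\<in>S. \<exists>v\<in>S. c u = i \<and> c v = j \<and> w u v \<noteq> 0)"
  shows "total S \<ge> real k * (real k - 1)"
proof -
  define D where "D = {p \<in> S \<times> S. w (fst p) (snd p) \<noteq> 0}"
  define K where "K = {p \<in> {..<k} \<times> {..<k}. fst p \<noteq> (snd p :: nat)}"
  have "K \<subseteq> (\<lambda>p. (c (fst p), c (snd p))) ` D"
  proof
    fix p assume "p \<in> K"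
    then obtain i j where p: "p = (i, j)" "i < k" "j < k" "i \<noteq> j"
      by (auto simp: K_def)
    then obtain u v where "u \<in> S" "v \<in> S" "c u = i" "c v = j" "w u v \<noteq> 0"
      using assms(2) by blast
    then show "p \<in> (\<lambda>p. (c (fst p), c (snd p))) ` D"
      using p(1) by (intro image_eqI[of _ _ "(u, v)"]) (auto simp: D_def)
  qed
  moreover have "finite D"
    using assms(1) by (simp add: D_def)
  ultimately have "card K \<le> card D"
    by (meson surj_card_le)
  have "{..<k} \<times> {..<k} = K \<union> (\<lambda>i. (i, i)) ` {..<k}" "K \<inter> (\<lambda>i. (i, i)) ` {..<k} = {}" "finite K"
    by (auto simp: K_def)
  then have "card ({..<k} \<times> {..<k}) = card K + card ((\<lambda>i. (i, i)) ` {..<k})"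
    by (metis card_Un_disjoint finite_imageI finite_lessThan)
  moreover have "card ((\<lambda>i. (i, i)) ` {..<k}) = k"
    by (simp add: card_image inj_on_def)
  ultimately have "k * k = card K + k"
    by simp
  then have "real k * (real k - 1) = card K"
    by (simp add: algebra_simps flip: of_nat_mult)
  also have "\<dots> \<le> card D"
    using \<open>card K \<le> card D\<close> by simp
  also have "\<dots> = (\<Sum>p\<in>D. 1)"
    by simp
  also have "\<dots> \<le> (\<Sum>p\<in>D. w (fst p) (snd p))"
    using weight by (intro sum_mono) (auto simp: D_def)
  also have "\<dots> \<le> (\<Sum>p\<in>S \<times> S. w (fst p) (snd p))"
    using assms(1) nonneg by (intro sum_mono2) (auto simp: D_def)
  also have "\<dots> = total S"
    by (simp add: total_def sum.cartesian_product case_prod_beta)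
  finally show ?thesis .
qed

text \<open>With s the square root, k (k - 1) \<le> \<open>total S\<close> says 2 k - 1 \<le> s, and
  4 \<open>total S\<close> = (s - 1) (s + 1). Hence \<open>total S\<close> / k is at least (s - 1) /
  2.\<close>

lemma gain_sqrt_total:
  assumes "finite S"
  shows "gain S ((sqrt (4 * total S + 1) - 1) / 2)"
proof (cases "S = {}")
  case True
  then show ?thesis
    using gain_empty by (simp add: total_def)
next
  case False
  obtain k c where kc: "proper S k c"
    "\<forall>i<k. \<forall>j<k. i \<noteq> j \<longrightarrow> (\<exists>u\<in>S. \<exists>v\<in>S. c u = i \<and> c v = j \<and> w u v \<noteq> 0)"
    using ex_complete_colouring[OF assms] by blast
  have "k > 0"
    using kc(1) False by (auto simp: proper_def)
  define s where "s = sqrt (4 * total S + 1)"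
  have "total S \<ge> 0"
    unfolding total_def using nonneg by (intro sum_nonneg) auto
  then have s2: "s\<^sup>2 = 4 * total S + 1" and s1: "s \<ge> 1"
    by (auto simp: s_def)
  have "(2 * real k - 1)\<^sup>2 \<le> s\<^sup>2"
    using total_ge[OF assms kc(2)] s2 by (simp add: power2_eq_square algebra_simps)
  then have "2 * real k - 1 \<le> s"
    using s1 by (auto elim: power2_le_imp_le)
  then have "(s - 1) * (2 * real k) \<le> (s - 1) * (s + 1)"
    using s1 by (intro mult_left_mono) auto
  also have "\<dots> = 4 * total S"
    using s2 by (simp add: power2_eq_square algebra_simps)
  finally have "(s - 1) / 2 \<le> total S / k"
    using \<open>k > 0\<close> by (simp add: field_simps)
  then show ?thesis
    using gain_total_div[OF assms kc(1) False] unfolding s_def by (rule gain_mono[rotated])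
qed

end

section \<open>The codegree graph and its translation to cuts\<close>

text \<open>On the diagonal the count would be the degree of the vertex; 0 keeps the graph
  loopless.\<close>

definition codegree :: "'a set set \<Rightarrow> 'a \<Rightarrow> 'a \<Rightarrow> real" where
  "codegree E u v = (if u = v then 0 else real (card {e \<in> E. u \<in> e \<and> v \<in> e}))"

interpretation codegree: weighted_graph "codegree E" for E :: "'a set set"
proof
  show "codegree E u v = codegree E v u" for u v
    by (simp add: codegree_def conj_commute)
  show "codegree E v v = 0" for v
    by (simp add: codegree_def)
  show "codegree E u v = 0 \<or> codegree E u v \<ge> 1" for u v
    by (auto simp: codegree_def Suc_le_eq)
qed

lemma codegree_nonzero:
  assumes "finite E"
  shows "codegree E u v \<noteq> 0 \<longleftrightarrow> u \<noteq> v \<and> (\<exists>e\<in>E. u \<in> e \<and> v \<in> e)"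
  using assms by (auto simp: codegree_def)

lemma uniform_hypergraph_finite:
  assumes "uniform_hypergraph k V E"
  shows "finite V" "finite E"
proof -
  have "E \<subseteq> Pow V" "finite V"
    using assms by (auto simp: uniform_hypergraph_def)
  then show "finite V" "finite E"
    by (auto intro: finite_subset)
qed

text \<open>Double counting of the edges together with an ordered pair of distinct vertices in
  them.\<close>

lemma sum_codegree:
  fixes f :: "'a \<Rightarrow> 'a \<Rightarrow> real"
  assumes "uniform_hypergraph k V E"
  shows "(\<Sum>u\<in>V. \<Sum>v\<in>V. codegree E u v * f u v) = (\<Sum>e\<in>E. \<Sum>u\<in>e. \<Sum>v\<in>e - {u}. f u v)"
proof -
  note fin = uniform_hypergraph_finite[OF assms]
  have cd: "codegree E u v = (\<Sum>e\<in>E. if u \<in> e \<and> v \<in> e - {u} then 1 else 0)" for u v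
    using fin(2) by (auto simp: codegree_def sum.If_cases Int_def intro!: arg_cong[of _ _ card])
  have "(\<Sum>u\<in>V. \<Sum>v\<in>V. codegree E u v * f u v)
      = (\<Sum>u\<in>V. \<Sum>v\<in>V. \<Sum>e\<in>E. if u \<in> e \<and> v \<in> e - {u} then f u v else 0)"
    unfolding cd sum_distrib_right by (intro sum.cong refl) simp
  also have "\<dots> = (\<Sum>u\<in>V. \<Sum>e\<in>E. \<Sum>v\<in>V. if u \<in> e \<and> v \<in> e - {u} then f u v else 0)"
    by (intro sum.cong refl sum.swap)
  also have "\<dots> = (\<Sum>e\<in>E. \<Sum>u\<in>V. \<Sum>v\<in>V. if u \<in> e \<and> v \<in> e - {u} then f u v else 0)"
    by (rule sum.swap)
  also have "\<dots> = (\<Sum>e\<in>E. \<Sum>u\<in>e. \<Sum>v\<in>e - {u}. f u v)"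
  proof (rule sum.cong[OF refl])
    fix e assume "e \<in> E"
    then have e: "e \<subseteq> V"
      using assms by (auto simp: uniform_hypergraph_def)
    have "(\<Sum>u\<in>V. \<Sum>v\<in>V. if u \<in> e \<and> v \<in> e - {u} then f u v else 0)
        = (\<Sum>u\<in>V. if u \<in> e then \<Sum>v\<in>e - {u}. f u v else 0)"
    proof (rule sum.cong[OF refl])
      fix u
      have "V \<inter> (e - {u}) = e - {u}"
        using e by auto
      then show "(\<Sum>v\<in>V. if u \<in> e \<and> v \<in> e - {u} then f u v else 0)
          = (if u \<in> e then \<Sum>v\<in>e - {u}. f u v else 0)"
        using sum.inter_restrict[OF fin(1), of "f u" "e - {u}"] by simp
    qed
    also have "\<dots> = (\<Sum>u\<in>e. \<Sum>v\<in>e - {u}. f u v)"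
      using sum.inter_restrict[OF fin(1), of "\<lambda>u. \<Sum>v\<in>e - {u}. f u v" e] e
      by (simp add: Int_absorb1)
    finally show "(\<Sum>u\<in>V. \<Sum>v\<in>V. if u \<in> e \<and> v \<in> e - {u} then f u v else 0)
        = (\<Sum>u\<in>e. \<Sum>v\<in>e - {u}. f u v)" .
  qed
  finally show ?thesis .
qed

lemma total_codegree:
  assumes "uniform_hypergraph 3 V E"
  shows "codegree.total E V = 6 * real (card E)"
proof -
  have "(\<Sum>u\<in>e. \<Sum>v\<in>e - {u}. 1 :: real) = 6" if "e \<in> E" for e
  proof -
    have "card e = 3"
      using assms that by (auto simp: uniform_hypergraph_def)
    then obtain a b c where "e = {a, b, c}" "a \<noteq> b" "b \<noteq> c" "a \<noteq> c"
      by (auto simp: card_3_iff)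
    then show ?thesis
      by (simp add: card_insert_if)
  qed
  then show ?thesis
    using sum_codegree[OF assms, of "\<lambda>_ _. 1"] by (simp add: codegree.total_def)
qed

text \<open>For signs x, y, z the product sum xy + yz + zx is 3 if all are equal and -1 otherwise.\<close>

lemma excess_eq_energy:
  assumes "uniform_hypergraph 3 V E" "is_cut 2 V P"
  shows "excess 3 2 E P = - codegree.energy E V (\<lambda>v. if v \<in> P 0 then 1 else -1) / 8"
proof -
  define x :: "'a \<Rightarrow> real" where "x v = (if v \<in> P 0 then 1 else -1)" for v
  have cut: "P 0 \<inter> P 1 = {}" "P 0 \<union> P 1 = V"
    using assms(2) by (auto simp: is_cut_def disjoint_family_on_def numeral_2_eq_2 less_Suc_eq)
  \<comment> \<open>In ordered pairs a monochromatic triple contributes 6 and a multicoloured one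
    -2.\<close>
  have e: "(\<Sum>u\<in>e. \<Sum>v\<in>e - {u}. x u * x v) = 6 - 8 * of_bool (multicoloured 2 P e)"
    if "e \<in> E" for e
  proof -
    have "card e = 3" "e \<subseteq> V"
      using assms(1) that by (auto simp: uniform_hypergraph_def)
    then obtain a b c where abc: "e = {a, b, c}" "a \<noteq> b" "b \<noteq> c" "a \<noteq> c"
      by (auto simp: card_3_iff)
    have "v \<in> P 1 \<longleftrightarrow> v \<notin> P 0" if "v \<in> e" for v
      using cut \<open>e \<subseteq> V\<close> that by blast
    then have "multicoloured 2 P e \<longleftrightarrow> (\<exists>v\<in>e. v \<in> P 0) \<and> (\<exists>v\<in>e. v \<notin> P 0)"
      by (auto simp: multicoloured_def numeral_2_eq_2 less_Suc_eq)
    moreover have "(\<Sum>u\<in>e. \<Sum>v\<in>e - {u}. x u * x v) = 2 * (x a * x b + x b * x c + x a * x c)"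
      using abc by (auto simp: insert_Diff_if algebra_simps)
    ultimately show ?thesis
      using abc(1) by (auto simp: x_def)
  qed
  have "codegree.energy E V x = (\<Sum>e\<in>E. 6 - 8 * of_bool (multicoloured 2 P e))"
    using sum_codegree[OF assms(1), of "\<lambda>u v. x u * x v"] e
    by (simp add: codegree.energy_def mult.assoc)
  also have "\<dots> = 6 * real (card E) - 8 * real (cut_size 2 E P)"
    using uniform_hypergraph_finite(2)[OF assms(1)]
    by (simp add: sum_subtractf sum_distrib_left[symmetric] cut_size_def Int_def)
  finally show ?thesis
    unfolding x_def excess_3_2 by simp
qed

lemma gain_imp_cut:
  assumes "uniform_hypergraph 3 V E" "codegree.gain E V g"
  shows "\<exists>P. is_cut 2 V P \<and> excess 3 2 E P \<ge> g / 8"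
proof -
  obtain x :: "'a \<Rightarrow> real" where x: "\<And>v. x v \<in> {-1, 1}" "codegree.energy E V x \<le> - g"
    using assms(2) unfolding codegree.gain_def by blast
  define P where "P i = {v \<in> V. (x v = 1) = (i = 0)}" for i :: nat
  have "is_cut 2 V P"
    by (auto simp: is_cut_def disjoint_family_on_def P_def numeral_2_eq_2 less_Suc_eq)
  moreover have "(if v \<in> P 0 then 1 else -1) = x v" if "v \<in> V" for v
    using x(1)[of v] that by (auto simp: P_def)
  then have "codegree.energy E V (\<lambda>v. if v \<in> P 0 then 1 else -1) = codegree.energy E V x"
    by (rule codegree.energy_cong)
  ultimately show ?thesis
    using excess_eq_energy[OF assms(1), of P] x(2) by auto
qed

lemma max_excess_eqI:
  assumes "uniform_hypergraph k V E" "is_cut r V P" "excess k r E P \<ge> a"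
    and "\<And>P. is_cut r V P \<Longrightarrow> excess k r E P \<le> a"
  shows "max_excess k r V E = a"
  unfolding max_excess_def
proof (rule Max_eqI)
  show "a \<in> {excess k r E P |P. is_cut r V P}"
    using assms(2-4) by (force intro: antisym)
qed (use assms finite_excess_values in auto)

lemma connected_rooted_codegree:
  assumes "uniform_hypergraph k V E" "connected_hypergraph V E" "r \<in> V"
  shows "codegree.rooted E V r"
proof -
  have "(v, r) \<in> (codegree.adj E V)\<^sup>*" if "(v, r) \<in> {(x, y). \<exists>e\<in>E. x \<in> e \<and> y \<in> e}\<^sup>*" for v
    using that
  proof (induction rule: converse_rtrancl_induct)
    case (step u v)
    \<comment> \<open>Two vertices sharing an edge may coincide; such a step is dropped from the
      path.\<close>
    then have "u = v \<or> (u, v) \<in> codegree.adj E V"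
      using assms(1) codegree_nonzero[OF uniform_hypergraph_finite(2)[OF assms(1)], of u v]
      by (auto simp: codegree.adj_def uniform_hypergraph_def)
    then show ?case
      using step.IH by (auto intro: converse_rtrancl_into_rtrancl)
  qed simp
  then show ?thesis
    using assms(2,3) by (auto simp: codegree.rooted_def connected_hypergraph_def)
qed

section \<open>Steiner triple systems\<close>

lemma steiner_codegree:
  assumes "steiner_triple_system V E" "u \<in> V" "v \<in> V"
  shows "codegree E u v = (if u = v then 0 else 1)"
proof (cases "u = v")
  case False
  then obtain e where "{e \<in> E. u \<in> e \<and> v \<in> e} = {e}"
    using assms unfolding steiner_triple_system_def by (smt (verit) Collect_cong singleton_conv)
  then show ?thesis
    using False by (simp add: codegree_def)
qed (simp add: codegree_def)

text \<open>The codegree matrix is the all-ones matrix minus the identity, and signs square to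
  1.\<close>

lemma steiner_energy:
  assumes "steiner_triple_system V E" "\<And>v. x v \<in> {-1, 1}"
  shows "codegree.energy E V x = (\<Sum>v\<in>V. x v)\<^sup>2 - real (card V)"
proof -
  have "finite V"
    using assms(1) by (simp add: steiner_triple_system_def uniform_hypergraph_def)
  have "codegree.energy E V x = (\<Sum>u\<in>V. \<Sum>v\<in>V. x u * x v - (if u = v then 1 else 0))"
    unfolding codegree.energy_def
  proof (intro sum.cong refl)
    fix u v assume "u \<in> V" "v \<in> V"
    then show "codegree E u v * x u * x v = x u * x v - (if u = v then 1 else 0)"
      using steiner_codegree[OF assms(1)] assms(2)[of u] by auto
  qed
  also have "\<dots> = (\<Sum>v\<in>V. x v)\<^sup>2 - real (card V)"
    using \<open>finite V\<close> by (simp add: sum_subtractf power2_eq_square sum_product)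
  finally show ?thesis .
qed

text \<open>The energy of the constant sign 1 is evaluated in two ways.\<close>

lemma steiner_card:
  assumes "steiner_triple_system V E"
  shows "6 * card E + card V = card V * card V"
proof -
  have u: "uniform_hypergraph 3 V E"
    using assms by (simp add: steiner_triple_system_def)
  have "codegree.energy E V (\<lambda>_. 1) = 6 * real (card E)"
    using total_codegree[OF u] by (simp add: codegree.energy_def codegree.total_def)
  then have "real (6 * card E + card V) = real (card V * card V)"
    using steiner_energy[OF assms, of "\<lambda>_. 1"] by (simp add: power2_eq_square)
  then show ?thesis
    by (rule of_nat_eq_iff[THEN iffD1])
qed

text \<open>The edges through a vertex pair up the remaining vertices.\<close>

lemma steiner_card_odd:
  assumes "steiner_triple_system V E"
  shows "odd (card V)"
proof -
  have u: "uniform_hypergraph 3 V E"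
    using assms by (simp add: steiner_triple_system_def)
  obtain r where r: "r \<in> V"
    using assms by (auto simp: steiner_triple_system_def)
  note fin = uniform_hypergraph_finite[OF u]
  define D where "D = {e \<in> E. r \<in> e}"
  have ex1: "\<exists>!e. e \<in> E \<and> r \<in> e \<and> v \<in> e" if "v \<in> V - {r}" for v
    using assms r that unfolding steiner_triple_system_def by (metis DiffE singletonI)
  have sub: "e \<subseteq> V" if "e \<in> E" for e
    using u that by (simp add: uniform_hypergraph_def)
  have "(\<Union>e\<in>D. e - {r}) = V - {r}"
    using ex1 sub by (fastforce simp: D_def)
  moreover have "card (\<Union>e\<in>D. e - {r}) = (\<Sum>e\<in>D. card (e - {r}))"
  proof (rule card_UN_disjoint)
    have "e = f" if "e \<in> D" "f \<in> D" "v \<in> e - {r}" "v \<in> f - {r}" for e f v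
      using ex1[of v] sub that by (auto simp: D_def)
    then show "\<forall>e\<in>D. \<forall>f\<in>D. e \<noteq> f \<longrightarrow> (e - {r}) \<inter> (f - {r}) = {}"
      by blast
    show "\<forall>e\<in>D. finite (e - {r})"
      using u fin(1) by (auto simp: D_def uniform_hypergraph_def intro: finite_subset)
  qed (use fin in \<open>simp add: D_def\<close>)
  moreover have "(\<Sum>e\<in>D. card (e - {r})) = (\<Sum>e\<in>D. 2)"
    using u by (intro sum.cong) (auto simp: D_def uniform_hypergraph_def)
  ultimately have "card V - 1 = 2 * card D"
    using r by simp
  moreover have "card V > 0"
    using r fin(1) by (auto simp: card_gt_0_iff)
  ultimately have "card V = 2 * card D + 1"
    by linarith
  then show ?thesis
    by simp
qed

lemma sum_signs_odd:
  assumes "finite V" "\<And>v. x v \<in> {-1, 1 :: real}"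
  shows "\<exists>j::int. (\<Sum>v\<in>V. x v) = of_int j \<and> (odd j \<longleftrightarrow> odd (card V))"
  using assms(1)
proof (induction V)
  case (insert v V)
  then obtain j :: int where "(\<Sum>v\<in>V. x v) = of_int j" "odd j \<longleftrightarrow> odd (card V)"
    by blast
  then show ?case
    using insert.hyps assms(2)[of v]
    by (intro exI[of _ "j + (if x v = 1 then 1 else -1)"]) auto
qed (auto intro: exI[of _ 0])

text \<open>The sum of an odd number of signs is an odd integer, so its square is at least 1 and the
  energy is at least 1 - \<open>card V\<close>.\<close>

lemma steiner_excess_le:
  assumes "steiner_triple_system V E" "is_cut 2 V P"
  shows "excess 3 2 E P \<le> (real (card V) - 1) / 8"
proof -
  have u: "uniform_hypergraph 3 V E"
    using assms by (simp add: steiner_triple_system_def)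
  define x :: "'a \<Rightarrow> real" where "x v = (if v \<in> P 0 then 1 else -1)" for v
  have x: "x v \<in> {-1, 1}" for v
    by (simp add: x_def)
  obtain j :: int where j: "(\<Sum>v\<in>V. x v) = of_int j" "odd j"
    using sum_signs_odd[of V x, OF uniform_hypergraph_finite(1)[OF u] x] steiner_card_odd[OF assms(1)]
    by blast
  have "j\<^sup>2 \<ge> 1"
    using j(2) by (smt (verit) even_zero zero_less_power2)
  then have "(\<Sum>v\<in>V. x v)\<^sup>2 \<ge> 1"
    unfolding j(1) by (metis of_int_1_le_iff of_int_power)
  then have "- codegree.energy E V x \<le> real (card V) - 1"
    using steiner_energy[OF assms(1), of x] x by simp
  then show ?thesis
    using excess_eq_energy[OF u assms(2)] unfolding x_def by simp
qed

lemma steiner_sqrt: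
  assumes "steiner_triple_system V E"
  shows "(sqrt (24 * real (card E) + 1) - 1) / 16 = (real (card V) - 1) / 8"
proof -
  have "real (6 * card E + card V) = real (card V * card V)"
    using steiner_card[OF assms] by simp
  then have "24 * real (card E) + 1 = (2 * real (card V) - 1)\<^sup>2"
    by (simp add: power2_eq_square algebra_simps)
  \<comment> \<open>Makes 2 \<open>card V\<close> - 1 nonnegative, hence equal to the square
    root.\<close>
  moreover have "card V \<ge> 1"
    using steiner_card_odd[OF assms] by (cases "card V") auto
  ultimately show ?thesis
    by simp
qed

section \<open>Perfect matchings and hypergraphs without isolated vertices\<close>

lemma matching_card:
  assumes "perfect_matching k V E"
  shows "card V = k * card E"
proof -
  have u: "uniform_hypergraph k V E"
    using assms by (simp add: perfect_matching_def)
  have ex1: "\<exists>!e. e \<in> E \<and> v \<in> e" if "v \<in> V" for v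
    using assms that by (simp add: perfect_matching_def)
  have sub: "e \<subseteq> V" if "e \<in> E" for e
    using u that by (simp add: uniform_hypergraph_def)
  have "V = \<Union> E"
    using ex1 sub by blast
  moreover have "card (\<Union> E) = sum card E"
  proof (rule card_Union_disjoint)
    show "pairwise disjnt E"
      using ex1 sub unfolding pairwise_def disjnt_def by blast
  qed (use u uniform_hypergraph_finite(1)[OF u] in
      \<open>auto simp: uniform_hypergraph_def intro: finite_subset\<close>)
  moreover have "sum card E = (\<Sum>e\<in>E. k)"
    using u by (intro sum.cong) (auto simp: uniform_hypergraph_def)
  ultimately show ?thesis
    by simp
qed

text \<open>At best all edges are multicoloured. For perfect matchings of triples this meets the
  lower bound \<open>n / 12\<close>.\<close>

lemma excess_le:
  assumes "finite E"
  shows "excess 3 2 E P \<le> real (card E) / 4"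
proof -
  have "cut_size 2 E P \<le> card E"
    unfolding cut_size_def using assms by (intro card_mono) auto
  then show ?thesis
    by (simp add: excess_3_2)
qed

text \<open>The other two vertices of an edge through v are distinct neighbours of v in the codegree
  graph.\<close>

lemma no_isolated_gain:
  assumes "uniform_hypergraph 3 V E" "\<forall>v\<in>V. \<not> isolated E v"
  shows "codegree.gain E V (2 / 3 * real (card V))"
proof (rule codegree.gain_min_degree_two)
  note fin = uniform_hypergraph_finite[OF assms(1)]
  show "finite V"
    by (rule fin)
  fix v assume "v \<in> V"
  then obtain e where e: "e \<in> E" "v \<in> e"
    using assms(2) by (auto simp: isolated_def)
  then have "card e = 3" "e \<subseteq> V"
    using assms(1) by (auto simp: uniform_hypergraph_def)
  then have "card (e - {v}) = 2"
    using e by simp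
  then obtain a b where ab: "e - {v} = {a, b}" "a \<noteq> b"
    by (auto simp: card_2_iff)
  then have "a \<in> e" "b \<in> e" "a \<noteq> v" "b \<noteq> v"
    by auto
  then show "\<exists>a\<in>V. \<exists>b\<in>V. a \<noteq> b \<and> codegree E v a \<noteq> 0 \<and> codegree E v b \<noteq> 0"
    unfolding codegree_nonzero[OF fin(2)] using ab(2) e \<open>e \<subseteq> V\<close> by blast
qed

theorem theorem1p1:
  fixes V :: "'a set" and E :: "'a set set" and n m :: nat
  assumes "uniform_hypergraph 3 V E" and "card V = n" and "card E = m"
  shows "(\<exists>P. is_cut 2 V P \<and> excess 3 2 E P \<ge> (sqrt (24 * real m + 1) - 1) / 16)
    \<and> (connected_hypergraph V E \<longrightarrow>
         (\<exists>P. is_cut 2 V P \<and> excess 3 2 E P \<ge> (real n - 1) / 8))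
    \<and> (steiner_triple_system V E \<longrightarrow>
         max_excess 3 2 V E = (sqrt (24 * real m + 1) - 1) / 16
         \<and> (sqrt (24 * real m + 1) - 1) / 16 = (real n - 1) / 8)
    \<and> ((\<forall>v\<in>V. \<not> isolated E v) \<longrightarrow>
         (\<exists>P. is_cut 2 V P \<and> excess 3 2 E P \<ge> real n / 12))
    \<and> (perfect_matching 3 V E \<longrightarrow> max_excess 3 2 V E = real n / 12)"
proof (intro conjI impI)
  note fin = uniform_hypergraph_finite[OF assms(1)]
  \<comment> \<open>The total codegree is 6 m, so the radicand is 24 m + 1; dividing the gain by 8
    leaves the denominator 16.\<close>
  have "codegree.gain E V ((sqrt (24 * real m + 1) - 1) / 2)"
    using codegree.gain_sqrt_total[OF fin(1), of E] total_codegree[OF assms(1)] assms(3) by simp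
  from gain_imp_cut[OF assms(1) this]
  show edwards: "\<exists>P. is_cut 2 V P \<and> excess 3 2 E P \<ge> (sqrt (24 * real m + 1) - 1) / 16"
    by simp
  show "\<exists>P. is_cut 2 V P \<and> excess 3 2 E P \<ge> (real n - 1) / 8" if "connected_hypergraph V E"
  proof (cases "V = {}")
    \<comment> \<open>With no vertex to serve as root, the claimed bound is -1/8, below the
      nonnegative square-root bound.\<close>
    case True
    then have "(real n - 1) / 8 \<le> (sqrt (24 * real m + 1) - 1) / 16"
      using assms(2) by auto
    then show ?thesis
      using edwards order_trans by blast
  next
    case False
    then obtain r where "r \<in> V"
      by blast
    then have "codegree.gain E V (real n - 1)"
      using codegree.rooted_gain[OF fin(1) connected_rooted_codegree[OF assms(1) that]] assms(2)
      by simp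
    then show ?thesis
      by (rule gain_imp_cut[OF assms(1)])
  qed
  show *: "(sqrt (24 * real m + 1) - 1) / 16 = (real n - 1) / 8" if "steiner_triple_system V E"
    using steiner_sqrt[OF that] assms by simp
  show "max_excess 3 2 V E = (sqrt (24 * real m + 1) - 1) / 16" if "steiner_triple_system V E"
    using edwards steiner_excess_le[OF that] *[OF that] assms(2) max_excess_eqI[OF assms(1)]
    by metis
  show non_isolated: "\<exists>P. is_cut 2 V P \<and> excess 3 2 E P \<ge> real n / 12"
    if "\<forall>v\<in>V. \<not> isolated E v"
    using gain_imp_cut[OF assms(1) no_isolated_gain[OF assms(1) that]] assms(2) by simp
  show "max_excess 3 2 V E = real n / 12" if "perfect_matching 3 V E"
  proof -
    have "\<forall>v\<in>V. \<not> isolated E v"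
      using that by (auto simp: perfect_matching_def isolated_def)
    moreover have "real n / 12 = real (card E) / 4"
      using matching_card[OF that] assms(2) by simp
    ultimately show ?thesis
      using non_isolated excess_le[OF fin(2)] max_excess_eqI[OF assms(1)] by metis
  qed
qed

end
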